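(* Let $r\geq 2$ be an integer and let $K_{n_1,n_2,\ldots,n_r}$ be the complete $r$-partite graph of order $n$ with parts $V_1,V_2,\ldots,V_r$, where $n_i=|V_i|\geq 1$ for $1\leq i\leq r$ and $\sum_{1\leq i\leq r}n_i=n$. For each $1\leq i\leq r$, let $H_i$ be a graph with vertex set $V(H_i)\subseteq V_i$. Let $G$ be the graph obtained from $K_{n_1,n_2,\ldots,n_r}$ by embedding the edges of $H_i$ into $V_i$ for all $1\leq i\leq r$ (that is, by adding all edges of $H_1,\ldots,H_r$). Set $\rho=\rho(G)$. Then $$\sum_{1\leq s\leq r}\frac{1}{1+\frac{n_s}{\rho}+\sum_{i=1}^{\infty}\frac{W^{i}(H_s)}{\rho^{i+1}}}=r-1.$$
   Context: All graphs are finite, undirected, without parallel edges or loops. The spectral radius $\rho(G)$ of a graph $G$ is the largest eigenvalue of its adjacency matrix. For an integer $\ell\geq 1$, a walk of length $\ell$ (an $\ell$-walk) in a graph $H$ is an ordered sequence of vertices $v_0,v_1,\ldots,v_\ell$ such that $v_i$ is adjacent to $v_{i+1}$ for every $0\leq i\leq \ell-1$; $v_0$ is its starting vertex. For a vertex $u$ of $H$, $w^{\ell}_H(u)$ is the number of $\ell$-walks in $H$ starting at $u$, and $W^{\ell}(H)=\sum_{u\in V(H)}w^{\ell}_H(u)$ is the total number of $\ell$-walks in $H$. *)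

theory Defs
  imports
    "Graph_Theory.Pair_Digraph"
    "Graph_Theory.Vertex_Walk"
    "Jordan_Normal_Form.Spectral_Radius"
    "HOL-Library.Disjoint_Sets"
begin

text \<open>
  A finite simple graph is a \<^locale>\<open>pair_graph\<close>: a finite vertex set with a symmetric, irreflexive
  set of arcs, each undirected edge being represented by its two orientations.
\<close>

definition adjacency_matrix :: "'a pair_pre_digraph \<Rightarrow> 'a list \<Rightarrow> real mat" where
  "adjacency_matrix G vs = mat (length vs) (length vs)
     (\<lambda>(i, j). if (vs ! i, vs ! j) \<in> parcs G then 1 else 0)"

definition vertex_enum :: "'a set \<Rightarrow> 'a list" where
  "vertex_enum S = (SOME vs. distinct vs \<and> set vs = S)"

text \<open>
  The matrix is real symmetric, so its real spectrum contains all its eigenvalues. The arbitrary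
  enumeration of the vertices is immaterial: see \<open>spectrum_adjacency_matrix_cong\<close> below.
\<close>

definition graph_spectral_radius :: "'a pair_pre_digraph \<Rightarrow> real" where
  "graph_spectral_radius G = Max (spectrum (adjacency_matrix G (vertex_enum (pverts G))))"

definition walks_from :: "'a pair_pre_digraph \<Rightarrow> nat \<Rightarrow> 'a \<Rightarrow> 'a list set" where
  "walks_from G l u = {p. vwalk p (with_proj G) \<and> vwalk_length p = l \<and> hd p = u}"

definition num_walks_from :: "'a pair_pre_digraph \<Rightarrow> nat \<Rightarrow> 'a \<Rightarrow> nat" where
  "num_walks_from G l u = card (walks_from G l u)"

definition num_walks :: "'a pair_pre_digraph \<Rightarrow> nat \<Rightarrow> nat" where
  "num_walks G l = (\<Sum>u\<in>pverts G. num_walks_from G l u)"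

definition complete_multipartite :: "'b set \<Rightarrow> ('b \<Rightarrow> 'a set) \<Rightarrow> 'a pair_pre_digraph" where
  "complete_multipartite I V =
     \<lparr>pverts = (\<Union>i\<in>I. V i), parcs = (\<Union>i\<in>I. \<Union>j\<in>I - {i}. V i \<times> V j)\<rparr>"

definition embed_edges :: "'a pair_pre_digraph \<Rightarrow> 'b set \<Rightarrow> ('b \<Rightarrow> 'a pair_pre_digraph)
    \<Rightarrow> 'a pair_pre_digraph" where
  "embed_edges K I H = \<lparr>pverts = pverts K, parcs = parcs K \<union> (\<Union>i\<in>I. parcs (H i))\<rparr>"

lemma vertex_enum:
  assumes "finite S"
  shows "distinct (vertex_enum S)" and "set (vertex_enum S) = S"
proof -
  have "distinct (vertex_enum S) \<and> set (vertex_enum S) = S"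
    unfolding vertex_enum_def
    using finite_distinct_list[OF assms] by - (rule someI_ex, blast)
  then show "distinct (vertex_enum S)" and "set (vertex_enum S) = S" by auto
qed

lemma eigenvalue_adjacency_matrix_iff:
  assumes d: "distinct vs"
  shows "eigenvalue (adjacency_matrix G vs) k \<longleftrightarrow>
    (\<exists>f. (\<exists>u\<in>set vs. f u \<noteq> 0) \<and>
         (\<forall>u\<in>set vs. (\<Sum>w\<in>{w \<in> set vs. (u, w) \<in> parcs G}. f w) = k * f u))"
proof -
  let ?n = "length vs" and ?A = "adjacency_matrix G vs"
  have dim: "dim_row ?A = ?n" "dim_col ?A = ?n" by (auto simp: adjacency_matrix_def)
  have bij: "bij_betw ((!) vs) {0..<?n} (set vs)"
    using d by (simp add: bij_betw_nth atLeast0LessThan)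
  have mult: "(?A *\<^sub>v v) $ i = (\<Sum>w\<in>{w \<in> set vs. (vs ! i, w) \<in> parcs G}. f w)"
    if "i < ?n" and "v \<in> carrier_vec ?n" and f: "\<And>j. j < ?n \<Longrightarrow> f (vs ! j) = v $ j" for v f i
  proof -
    have "(?A *\<^sub>v v) $ i = (\<Sum>j\<in>{0..<?n}. (if (vs ! i, vs ! j) \<in> parcs G then 1 else 0) * v $ j)"
      using that by (auto simp: adjacency_matrix_def scalar_prod_def intro!: sum.cong)
    also have "\<dots> = (\<Sum>j\<in>{0..<?n}. if (vs ! i, vs ! j) \<in> parcs G then f (vs ! j) else 0)"
      using f by (intro sum.cong) auto
    also have "\<dots> = (\<Sum>w\<in>set vs. if (vs ! i, w) \<in> parcs G then f w else 0)"
      by (rule sum.reindex_bij_betw[OF bij])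
    also have "\<dots> = (\<Sum>w\<in>{w \<in> set vs. (vs ! i, w) \<in> parcs G}. f w)"
      by (simp add: sum.inter_filter)
    finally show ?thesis .
  qed
  show ?thesis
  proof
    assume "eigenvalue ?A k"
    then obtain v where v: "v \<in> carrier_vec ?n" "v \<noteq> 0\<^sub>v ?n" "?A *\<^sub>v v = k \<cdot>\<^sub>v v"
      by (auto simp: eigenvalue_def eigenvector_def dim)
    define f where "f w = v $ (inv_into {0..<?n} ((!) vs) w)" for w
    have f: "f (vs ! j) = v $ j" if "j < ?n" for j
      using inv_into_f_f[OF bij_betw_imp_inj_on[OF bij], of j] that by (simp add: f_def)
    from v(1,2) obtain i where "i < ?n" "v $ i \<noteq> 0" by (metis carrier_vecD eq_vecI index_zero_vec)
    then have nz: "\<exists>u\<in>set vs. f u \<noteq> 0" using f by (metis nth_mem)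
    have "(\<Sum>w\<in>{w \<in> set vs. (u, w) \<in> parcs G}. f w) = k * f u" if u: "u \<in> set vs" for u
    proof -
      obtain i where i: "i < ?n" "u = vs ! i" using u by (metis in_set_conv_nth)
      have "(\<Sum>w\<in>{w \<in> set vs. (vs ! i, w) \<in> parcs G}. f w) = (k \<cdot>\<^sub>v v) $ i"
        using mult[OF i(1) v(1) f] v(3) by simp
      then show ?thesis using i v(1) f by simp
    qed
    with nz show "\<exists>f. (\<exists>u\<in>set vs. f u \<noteq> 0) \<and>
         (\<forall>u\<in>set vs. (\<Sum>w\<in>{w \<in> set vs. (u, w) \<in> parcs G}. f w) = k * f u)" by blast
  next
    assume "\<exists>f. (\<exists>u\<in>set vs. f u \<noteq> 0) \<and>
         (\<forall>u\<in>set vs. (\<Sum>w\<in>{w \<in> set vs. (u, w) \<in> parcs G}. f w) = k * f u)"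
    then obtain f where nz: "\<exists>u\<in>set vs. f u \<noteq> 0"
      and f: "\<And>u. u \<in> set vs \<Longrightarrow> (\<Sum>w\<in>{w \<in> set vs. (u, w) \<in> parcs G}. f w) = k * f u"
      by blast
    define v where "v = vec ?n (\<lambda>i. f (vs ! i))"
    have v: "v \<in> carrier_vec ?n" "\<And>j. j < ?n \<Longrightarrow> f (vs ! j) = v $ j" by (auto simp: v_def)
    have "v \<noteq> 0\<^sub>v ?n"
      using nz v(2) by (metis in_set_conv_nth index_zero_vec(1))
    moreover have "?A *\<^sub>v v = k \<cdot>\<^sub>v v"
      using mult[OF _ v] f v by (intro eq_vecI) (auto simp: dim)
    ultimately show "eigenvalue ?A k"
      using v(1) by (auto simp: eigenvalue_def eigenvector_def dim)
  qed
qed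

lemma spectrum_adjacency_matrix_cong:
  assumes "distinct vs" "distinct ws" "set vs = set ws"
  shows "spectrum (adjacency_matrix G vs) = spectrum (adjacency_matrix G ws)"
  unfolding spectrum_def eigenvalue_adjacency_matrix_iff[OF assms(1)]
    eigenvalue_adjacency_matrix_iff[OF assms(2)] assms(3) ..

lemma pair_graph_multipartite_embed:
  assumes "finite I" and "\<And>i. i \<in> I \<Longrightarrow> finite (V i)" and dj: "disjoint_family_on V I"
    and H: "\<And>i. i \<in> I \<Longrightarrow> pair_graph (H i)" and HV: "\<And>i. i \<in> I \<Longrightarrow> pverts (H i) \<subseteq> V i"
  shows "pair_graph (embed_edges (complete_multipartite I V) I H)"
proof -
  let ?G = "embed_edges (complete_multipartite I V) I H"
  have sub: "parcs (H i) \<subseteq> V i \<times> V i" if "i \<in> I" for i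
  proof -
    interpret pair_graph "H i" by (rule H[OF that])
    show ?thesis using HV[OF that] arc_fst_in_verts arc_snd_in_verts by fastforce
  qed
  have fin: "finite (pverts ?G)"
    using assms(1,2) by (simp add: embed_edges_def complete_multipartite_def)
  have arcs: "parcs ?G \<subseteq> pverts ?G \<times> pverts ?G"
    using sub by (fastforce simp: embed_edges_def complete_multipartite_def)
  have sym_H: "(v, u) \<in> parcs (H i)" if "i \<in> I" "(u, v) \<in> parcs (H i)" for i u v
  proof -
    interpret pair_graph "H i" by (rule H[OF that(1)])
    show ?thesis using that(2) pair_sym_arcs by (auto simp: symmetric_def sym_def)
  qed
  have irr_H: "(u, u) \<notin> parcs (H i)" if "i \<in> I" for i u
  proof -
    interpret pair_graph "H i" by (rule H[OF that])
    show ?thesis using pair_no_loops[of "(u, u)"] by auto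
  qed
  have parcs_G: "parcs ?G = (\<Union>i\<in>I. \<Union>j\<in>I - {i}. V i \<times> V j) \<union> (\<Union>i\<in>I. parcs (H i))"
    by (simp add: embed_edges_def complete_multipartite_def)
  have sym: "(v, u) \<in> parcs ?G" if "(u, v) \<in> parcs ?G" for u v
    using that[unfolded parcs_G]
  proof (elim UnE UN_E)
    fix i j assume "i \<in> I" "j \<in> I - {i}" "(u, v) \<in> V i \<times> V j"
    then show ?thesis unfolding parcs_G by (intro UnI1 UN_I[of j] UN_I[of i]) auto
  next
    fix i assume "i \<in> I" "(u, v) \<in> parcs (H i)"
    then show ?thesis unfolding parcs_G by (intro UnI2 UN_I[of i]) (auto intro: sym_H)
  qed
  have irr: "(u, u) \<notin> parcs ?G" for u
  proof
    assume "(u, u) \<in> parcs ?G"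
    then show False unfolding parcs_G
    proof (elim UnE UN_E)
      fix i j assume "i \<in> I" "j \<in> I - {i}" "(u, u) \<in> V i \<times> V j"
      then show False using dj unfolding disjoint_family_on_def by blast
    next
      fix i assume "i \<in> I" "(u, u) \<in> parcs (H i)"
      then show False using irr_H by blast
    qed
  qed
  show ?thesis
  proof
    show "finite (pverts ?G)" by (rule fin)
    show "finite (parcs ?G)" by (rule finite_subset[OF arcs finite_cartesian_product[OF fin fin]])
    have "sym (parcs ?G)" by (rule symI) (rule sym)
    then show "symmetric ?G" by (simp add: symmetric_def)
    fix e assume e: "e \<in> parcs ?G"
    show "fst e \<in> pverts ?G" "snd e \<in> pverts ?G"
      using subsetD[OF arcs e] by (simp_all only: mem_Times_iff)
    show "fst e \<noteq> snd e" using e irr[of "fst e"] by (metis prod.collapse)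
  qed
qed

end

theory Submission
  imports Defs "HOL-Analysis.Function_Topology"
begin

text \<open>
  Let \<open>x\<close> be a nonnegative eigenvector for \<open>\<rho>\<close>, let \<open>T\<close> be the sum of its entries, and let
  \<open>c s\<close> be the sum of its entries outside the part \<open>V s\<close>. A vertex \<open>u\<close> of \<open>V s\<close> is adjacent to
  everything outside \<open>V s\<close> and, inside \<open>V s\<close>, to its neighbours in \<open>H s\<close>, so the eigenvalue
  equation at \<open>u\<close> reads \<open>\<rho> x(u) = c s + (sum of x over the H s-neighbours of u)\<close>: within one part
  the rest of the graph contributes only the constant \<open>c s\<close>.

  Solving this equation by iteration gives a Neumann series, the coefficient of \<open>c s / \<rho>^(l+1)\<close> in
  \<open>x(u)\<close> being the number of walks of length \<open>l\<close> in \<open>H s\<close> from \<open>u\<close>; this is \<open>walk_series_sums\<close>.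
  Summing over \<open>V s\<close> yields \<open>T - c s = c s * F s\<close>, where \<open>F s\<close> is \<open>n s / \<rho>\<close> plus the series of the
  theorem. Hence \<open>1 / (1 + F s) = c s / T\<close>, and since every vertex lies outside exactly \<open>r - 1\<close>
  parts, these fractions add up to \<open>r - 1\<close>.

  The eigenvector comes from maximising the quadratic form of the adjacency matrix over unit vectors:
  the maximum is the largest eigenvalue, and replacing entries by their absolute values does not
  decrease the form (\<open>nonneg_eigenvector_max_eigenvalue\<close>). The complete
  multipartite structure then gives positivity: a positive entry in one part forces positive entries
  in all other parts, so \<open>\<rho>\<close> and all \<open>c s\<close> are positive.
\<close>

section \<open>The largest eigenvalue of a nonnegative symmetric kernel\<close>

text \<open>
  Vectors indexed by \<open>S\<close> are functions vanishing outside \<open>S\<close>; this makes the unit cube a product of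
  compact factors indexed by the whole type, so that Tychonoff's theorem gives compactness.
\<close>

lemma compact_nonneg_unit_vectors:
  fixes S :: "'a set"
  assumes "finite S"
  shows "compact {f :: 'a \<Rightarrow> real. (\<forall>u. 0 \<le> f u) \<and> (\<forall>u. u \<notin> S \<longrightarrow> f u = 0) \<and> (\<Sum>u\<in>S. (f u)\<^sup>2) = 1}"
    (is "compact ?K")
proof -
  have box: "compact (PiE UNIV (\<lambda>u. if u \<in> S then {0..1} else {0}) :: ('a \<Rightarrow> real) set)"
    (is "compact ?B")
    unfolding compactin_euclidean_iff[symmetric] euclidean_product_topology[symmetric] compactin_PiE
    by (simp add: compactin_euclidean_iff)
  have "continuous_on UNIV (\<lambda>f :: 'a \<Rightarrow> real. \<Sum>u\<in>S. (f u)\<^sup>2)"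
    by (intro continuous_intros continuous_on_product_coordinates)
  then have "closed {f :: 'a \<Rightarrow> real. (\<Sum>u\<in>S. (f u)\<^sup>2) = 1}"
    by (intro closed_Collect_eq) auto
  moreover have "?K = ?B \<inter> {f. (\<Sum>u\<in>S. (f u)\<^sup>2) = 1}"
  proof (intro equalityI subsetI)
    fix f assume f: "f \<in> ?K"
    have "f u \<le> 1" if "u \<in> S" for u
    proof -
      have "(f u)\<^sup>2 \<le> (\<Sum>u\<in>S. (f u)\<^sup>2)" using assms that by (intro member_le_sum) auto
      then show ?thesis using f by (auto simp: power2_le_iff_abs_le abs_square_le_1)
    qed
    then show "f \<in> ?B \<inter> {f. (\<Sum>u\<in>S. (f u)\<^sup>2) = 1}" using f by (auto simp: PiE_iff)
  next
    fix f assume "f \<in> ?B \<inter> {f. (\<Sum>u\<in>S. (f u)\<^sup>2) = 1}"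
    then have f: "f u \<in> (if u \<in> S then {0..1} else {0})" "(\<Sum>u\<in>S. (f u)\<^sup>2) = 1" for u
      by (auto simp: PiE_iff)
    have "0 \<le> f u" "u \<notin> S \<longrightarrow> f u = 0" for u
      using f(1)[of u] by (auto split: if_splits)
    then show "f \<in> ?K" using f(2) by auto
  qed
  ultimately show ?thesis using compact_Int_closed[OF box] by simp
qed

definition kernel_form :: "'a set \<Rightarrow> ('a \<Rightarrow> 'a \<Rightarrow> real) \<Rightarrow> ('a \<Rightarrow> real) \<Rightarrow> ('a \<Rightarrow> real) \<Rightarrow> real" where
  "kernel_form S a f g = (\<Sum>u\<in>S. f u * (\<Sum>w\<in>S. a u w * g w))"

lemma kernel_form_commute:
  assumes "\<And>u w. a u w = a w u"
  shows "kernel_form S a f g = kernel_form S a g f"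
proof -
  have "kernel_form S a f g = (\<Sum>u\<in>S. \<Sum>w\<in>S. f u * (a u w * g w))"
    by (simp add: kernel_form_def sum_distrib_left)
  also have "\<dots> = (\<Sum>w\<in>S. \<Sum>u\<in>S. f u * (a u w * g w))" by (rule sum.swap)
  also have "\<dots> = kernel_form S a g f"
    using assms by (auto simp: kernel_form_def sum_distrib_left mult_ac intro!: sum.cong)
  finally show ?thesis .
qed

lemma kernel_form_add_scaled:
  assumes "\<And>u w. a u w = a w u"
  shows "kernel_form S a (\<lambda>u. f u + t * g u) (\<lambda>u. f u + t * g u) =
    kernel_form S a f f + 2 * t * kernel_form S a g f + t\<^sup>2 * kernel_form S a g g"
proof -
  have "kernel_form S a (\<lambda>u. f u + t * g u) (\<lambda>u. f u + t * g u) =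
    kernel_form S a f f + t * kernel_form S a f g + t * kernel_form S a g f + t\<^sup>2 * kernel_form S a g g"
    by (simp add: kernel_form_def algebra_simps sum.distrib sum_distrib_left power2_eq_square)
  then show ?thesis using kernel_form_commute[of a S f g] assms by simp
qed

text \<open>
  The first-order condition at a minimum: near \<open>t = 0\<close> the linear term dominates, so a small negative
  \<open>t\<close> gives the bound.
\<close>

lemma linear_coeff_le_zero:
  fixes b c :: real
  assumes "\<And>t. 0 \<le> 2 * t * c + t\<^sup>2 * b"
  shows "c \<le> 0"
proof (rule ccontr)
  assume "\<not> c \<le> 0"
  then have c: "c > 0" by simp
  \<comment> \<open>The step \<open>-s\<close> is small enough for \<open>s * b\<close> not to outweigh \<open>2 * c\<close>, whatever the sign of \<open>b\<close>.\<close>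
  define s where "s = c / (\<bar>b\<bar> + 1)"
  have s: "s > 0" using c by (simp add: s_def)
  have "s * \<bar>b\<bar> < c" using c by (simp add: s_def field_simps)
  moreover have "s * b \<le> s * \<bar>b\<bar>" using s by simp
  ultimately have "s * b < c" by linarith
  then have "s * (s * b - 2 * c) < 0" using s c by (intro mult_pos_neg) auto
  moreover have "0 \<le> s * (s * b - 2 * c)"
    using assms[of "- s"] by (simp add: algebra_simps power2_eq_square)
  ultimately show False by simp
qed

text \<open>
  The Perron vector, by the Rayleigh principle. The form attains its maximum \<open>\<rho>\<close> over nonnegative unit
  vectors at some \<open>x\<close>. As the kernel is nonnegative, passing from \<open>f\<close> to \<open>|f|\<close> does not decrease the
  form, so \<open>\<rho>\<close> bounds the Rayleigh quotient of every vector, and in particular every eigenvalue. Since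
  the bound allows variations of \<open>x\<close> in all directions, \<open>x\<close> is a critical point, that is, an
  eigenvector.
\<close>

lemma nonneg_eigenvector_max_eigenvalue:
  fixes a :: "'a \<Rightarrow> 'a \<Rightarrow> real"
  assumes fin: "finite S" and ne: "S \<noteq> {}"
    and nonneg: "\<And>u w. 0 \<le> a u w" and a_sym: "\<And>u w. a u w = a w u"
  obtains x \<rho> where "\<And>u. 0 \<le> x u" and "\<exists>u\<in>S. 0 < x u"
    and "\<And>u. u \<in> S \<Longrightarrow> (\<Sum>w\<in>S. a u w * x w) = \<rho> * x u"
    and "\<And>f k u. \<lbrakk>u \<in> S; f u \<noteq> 0; \<And>u. u \<in> S \<Longrightarrow> (\<Sum>w\<in>S. a u w * f w) = k * f u\<rbrakk> \<Longrightarrow> k \<le> \<rho>"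
proof -
  define K where "K = {f :: 'a \<Rightarrow> real. (\<forall>u. 0 \<le> f u) \<and> (\<forall>u. u \<notin> S \<longrightarrow> f u = 0) \<and> (\<Sum>u\<in>S. (f u)\<^sup>2) = 1}"
  let ?q = "\<lambda>f. kernel_form S a f f" and ?N = "\<lambda>f. \<Sum>u\<in>S. (f u)\<^sup>2 :: real"
  obtain z where z: "z \<in> S" using ne by blast
  have "(\<lambda>u. if u = z then 1 else 0) \<in> K"
    using z fin by (simp add: K_def if_distrib[of "\<lambda>t. t\<^sup>2"] cong: if_cong)
  then have "K \<noteq> {}" by blast
  moreover have "continuous_on UNIV ?q"
    unfolding kernel_form_def
    by (intro continuous_on_sum continuous_on_mult continuous_on_const
        continuous_on_product_coordinates)
  then have "continuous_on K ?q" by (rule continuous_on_subset) simp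
  ultimately obtain x where x: "x \<in> K" and max: "\<And>f. f \<in> K \<Longrightarrow> ?q f \<le> ?q x"
    using continuous_attains_sup[OF compact_nonneg_unit_vectors[OF fin]] unfolding K_def[symmetric] by blast
  define \<rho> where "\<rho> = ?q x"
  have rayleigh: "?q f \<le> \<rho> * ?N f" for f
  proof (cases "?N f = 0")
    case True
    then have "\<forall>u\<in>S. f u = 0" using fin by (simp add: sum_nonneg_eq_0_iff)
    then have "?q f = 0" by (simp add: kernel_form_def)
    then show ?thesis using True by simp
  next
    case False
    then have pos: "?N f > 0" by (simp add: order.not_eq_order_implies_strict sum_nonneg)
    define g where "g u = (if u \<in> S then \<bar>f u\<bar> / sqrt (?N f) else 0)" for u
    have "?N g = (\<Sum>u\<in>S. (f u)\<^sup>2 / ?N f)"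
      using pos by (intro sum.cong) (auto simp: g_def power_divide)
    also have "\<dots> = 1" using pos by (simp add: sum_divide_distrib[symmetric])
    finally have "g \<in> K" using pos by (auto simp: K_def g_def)
    then have g: "?q g \<le> \<rho>" unfolding \<rho>_def by (rule max)
    have sq: "sqrt (?N f) * sqrt (?N f) = ?N f" using pos by simp
    have "?q f \<le> (\<Sum>u\<in>S. \<Sum>w\<in>S. \<bar>f u\<bar> * (a u w * \<bar>f w\<bar>))"
      unfolding kernel_form_def sum_distrib_left
    proof (intro sum_mono)
      fix u w
      have "f u * (a u w * f w) \<le> \<bar>f u * (a u w * f w)\<bar>" by (rule abs_ge_self)
      then show "f u * (a u w * f w) \<le> \<bar>f u\<bar> * (a u w * \<bar>f w\<bar>)"
        using nonneg[of u w] by (simp add: abs_mult)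
    qed
    also have "\<dots> = (\<Sum>u\<in>S. \<Sum>w\<in>S. ?N f * (g u * (a u w * g w)))"
    proof (intro sum.cong refl)
      fix u w assume "u \<in> S" "w \<in> S"
      then have "?N f * (g u * (a u w * g w)) = ?N f * (\<bar>f u\<bar> * (a u w * \<bar>f w\<bar>)) / (sqrt (?N f) * sqrt (?N f))"
        by (simp add: g_def)
      also have "\<dots> = \<bar>f u\<bar> * (a u w * \<bar>f w\<bar>)"
        unfolding sq using pos by (intro nonzero_mult_div_cancel_left) auto
      finally show "\<bar>f u\<bar> * (a u w * \<bar>f w\<bar>) = ?N f * (g u * (a u w * g w))" ..
    qed
    also have "\<dots> = ?N f * ?q g" by (simp add: kernel_form_def sum_distrib_left)
    also have "\<dots> \<le> ?N f * \<rho>" using g pos by simp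
    finally show ?thesis by (simp add: mult.commute)
  qed
  \<comment> \<open>Varying \<open>x\<close> in the direction of its own residual \<open>d\<close> makes the linear coefficient the squared norm
    of \<open>d\<close>, so optimality forces the residual to vanish.\<close>
  define d where "d u = \<rho> * x u - (\<Sum>w\<in>S. a u w * x w)" for u
  have Nx: "?N x = 1" using x by (simp add: K_def)
  have "?N d \<le> 0"
  proof (rule linear_coeff_le_zero)
    fix t
    have form: "?q (\<lambda>u. x u + t * d u) = \<rho> + 2 * t * kernel_form S a d x + t\<^sup>2 * ?q d"
      unfolding \<rho>_def by (rule kernel_form_add_scaled[OF a_sym])
    have norm: "?N (\<lambda>u. x u + t * d u) = 1 + 2 * t * (\<Sum>u\<in>S. d u * x u) + t\<^sup>2 * ?N d"
      unfolding Nx[symmetric]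
      by (simp add: power2_eq_square algebra_simps sum.distrib sum_distrib_left)
    have Nd: "?N d = \<rho> * (\<Sum>u\<in>S. d u * x u) - kernel_form S a d x"
    proof -
      have "?N d = (\<Sum>u\<in>S. d u * (\<rho> * x u - (\<Sum>w\<in>S. a u w * x w)))"
        by (simp add: power2_eq_square d_def)
      then show ?thesis
        by (simp add: kernel_form_def right_diff_distrib sum_subtractf sum_distrib_left mult_ac)
    qed
    have "2 * t * ?N d + t\<^sup>2 * (\<rho> * ?N d - ?q d) =
        \<rho> * ?N (\<lambda>u. x u + t * d u) - ?q (\<lambda>u. x u + t * d u)"
      unfolding form norm Nd by (simp add: algebra_simps)
    then show "0 \<le> 2 * t * ?N d + t\<^sup>2 * (\<rho> * ?N d - ?q d)"
      using rayleigh[of "\<lambda>u. x u + t * d u"] by linarith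
  qed
  then have "?N d = 0" using sum_nonneg[of S "\<lambda>u. (d u)\<^sup>2"] by simp
  then have d0: "\<forall>u\<in>S. d u = 0" using fin by (simp add: sum_nonneg_eq_0_iff)
  show thesis
  proof (rule that[of x "\<rho>"])
    show "0 \<le> x u" for u using x by (simp add: K_def)
    show "\<exists>u\<in>S. 0 < x u"
    proof (rule ccontr)
      assume "\<not> (\<exists>u\<in>S. 0 < x u)"
      then have "\<forall>u\<in>S. x u = 0" using x by (auto simp: K_def order.order_iff_strict)
      then show False using Nx by simp
    qed
    show "(\<Sum>w\<in>S. a u w * x w) = \<rho> * x u" if "u \<in> S" for u
      using d0 that by (simp add: d_def)
    fix f k u
    assume u: "u \<in> S" "f u \<noteq> 0" and f: "\<And>u. u \<in> S \<Longrightarrow> (\<Sum>w\<in>S. a u w * f w) = k * f u"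
    have "(f u)\<^sup>2 \<le> ?N f" using u(1) fin by (intro member_le_sum) auto
    then have pos: "?N f > 0" using u(2) by (smt (verit) zero_less_power2)
    have "?q f = k * ?N f"
      using f by (simp add: kernel_form_def sum_distrib_left power2_eq_square mult_ac)
    then have "k * ?N f \<le> \<rho> * ?N f" using rayleigh[of f] by simp
    then show "k \<le> \<rho>" using pos by simp
  qed
qed

lemma graph_spectral_radius_eigenvector:
  assumes "pair_graph G" and ne: "pverts G \<noteq> {}"
  obtains x where "\<And>u. 0 \<le> x u" and "\<exists>u\<in>pverts G. 0 < x u"
    and "\<And>u. u \<in> pverts G \<Longrightarrow> (\<Sum>w\<in>parcs G `` {u}. x w) = graph_spectral_radius G * x u"
proof -
  interpret pair_graph G by fact
  let ?S = "pverts G" and ?A = "adjacency_matrix G (vertex_enum (pverts G))"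
  define a where "a u w = (if (u, w) \<in> parcs G then 1 else 0 :: real)" for u w
  have a_sym: "a u w = a w u" for u w
    using pair_sym_arcs by (auto simp: a_def symmetric_def sym_def)
  have enum: "distinct (vertex_enum ?S)" "set (vertex_enum ?S) = ?S"
    using vertex_enum[OF pair_finite_verts] by auto
  have row: "(\<Sum>w\<in>?S. a u w * f w) = (\<Sum>w\<in>{w \<in> ?S. (u, w) \<in> parcs G}. f w)" for u f
    by (simp add: a_def if_distrib[of "\<lambda>t. t * _"] sum.inter_filter cong: if_cong)
  have nbrs: "{w \<in> ?S. (u, w) \<in> parcs G} = parcs G `` {u}" for u
    using arc_snd_in_verts by fastforce
  obtain x \<rho> where x: "\<And>u. 0 \<le> x u" "\<exists>u\<in>?S. 0 < x u"
    and eig: "\<And>u. u \<in> ?S \<Longrightarrow> (\<Sum>w\<in>?S. a u w * x w) = \<rho> * x u"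
    and max: "\<And>f k u. \<lbrakk>u \<in> ?S; f u \<noteq> 0; \<And>u. u \<in> ?S \<Longrightarrow> (\<Sum>w\<in>?S. a u w * f w) = k * f u\<rbrakk>
        \<Longrightarrow> k \<le> \<rho>"
    by (rule nonneg_eigenvector_max_eigenvalue[of ?S a])
      (use pair_finite_verts ne a_sym in \<open>auto simp: a_def\<close>)
  have ev: "eigenvalue ?A k \<longleftrightarrow> (\<exists>f. (\<exists>u\<in>?S. f u \<noteq> 0) \<and>
      (\<forall>u\<in>?S. (\<Sum>w\<in>?S. a u w * f w) = k * f u))" for k
    unfolding eigenvalue_adjacency_matrix_iff[OF enum(1)] enum(2) row ..
  have "?A \<in> carrier_mat (length (vertex_enum ?S)) (length (vertex_enum ?S))"
    by (simp add: adjacency_matrix_def)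
  then have "Max (spectrum ?A) = \<rho>"
  proof (intro Max_eqI card_finite_spectrum(1))
    show "k \<le> \<rho>" if "k \<in> spectrum ?A" for k
      using that max unfolding spectrum_def mem_Collect_eq ev by blast
    show "\<rho> \<in> spectrum ?A"
      unfolding spectrum_def mem_Collect_eq ev using x eig by (intro exI[of _ x]) force
  qed
  then have "graph_spectral_radius G = \<rho>" by (simp add: graph_spectral_radius_def)
  then show thesis using that[of x] x eig unfolding row nbrs by blast
qed

section \<open>Walk generating functions\<close>

text \<open>
  The walks of length 0 are counted at every element of the type. For a graph \<open>H\<close> on a subset of \<open>V\<close>, the
  total of \<open>walk_count (parcs H) 0\<close> over \<open>V\<close> is thus the size of \<open>V\<close>, vertices of \<open>V\<close> outside \<open>H\<close>
  behaving as isolated vertices of \<open>H\<close>.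
\<close>

primrec walk_count :: "('a \<times> 'a) set \<Rightarrow> nat \<Rightarrow> 'a \<Rightarrow> nat" where
  "walk_count R 0 u = 1"
| "walk_count R (Suc l) u = (\<Sum>w\<in>R `` {u}. walk_count R l w)"

lemma walks_from_Suc:
  assumes "pair_graph H" and "u \<in> pverts H"
  shows "walks_from H (Suc l) u = (#) u ` (\<Union>w\<in>parcs H `` {u}. walks_from H l w)"
proof -
  have 1: "p \<in> (#) u ` (\<Union>w\<in>parcs H `` {u}. walks_from H l w)"
    if "p \<in> walks_from H (Suc l) u" for p
  proof -
    from that obtain w q where p: "p = u # w # q"
      by (cases p rule: vwalk_arcs.cases) (auto simp: walks_from_def)
    with that have "w # q \<in> walks_from H l w" "w \<in> parcs H `` {u}"
      by (auto simp: walks_from_def vwalk_def arcs_ends_def arc_to_ends_def)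
    then show ?thesis using p by blast
  qed
  have 2: "u # p \<in> walks_from H (Suc l) u"
    if "(u, w) \<in> parcs H" "p \<in> walks_from H l w" for p w
  proof -
    have "p \<noteq> []" using that(2) by (auto simp: walks_from_def vwalk_def)
    moreover have "hd p = w" using that(2) by (simp add: walks_from_def)
    ultimately obtain q where "p = w # q" by (cases p) auto
    then show ?thesis using that assms(2)
      by (auto simp: walks_from_def vwalk_def arcs_ends_def arc_to_ends_def)
  qed
  show ?thesis using 1 2 by blast
qed

lemma num_walks_from_eq_walk_count:
  assumes "pair_graph H" and "u \<in> pverts H"
  shows "finite (walks_from H l u) \<and> num_walks_from H l u = walk_count (parcs H) l u"
  using assms(2)
proof (induction l arbitrary: u)
  case 0
  have "walks_from H 0 u = {[u]}"
  proof (intro equalityI subsetI)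
    fix p assume "p \<in> walks_from H 0 u"
    then have "p \<noteq> []" "length p \<le> 1" "hd p = u" by (auto simp: walks_from_def vwalk_def)
    then show "p \<in> {[u]}" by (cases p) auto
  qed (use 0 in \<open>auto simp: walks_from_def vwalk_def\<close>)
  then show ?case by (simp add: num_walks_from_def)
next
  case (Suc l)
  interpret pair_graph H by fact
  have fin: "finite (parcs H `` {u})" using pair_finite_arcs by (rule finite_Image)
  have nbr: "w \<in> pverts H" if "w \<in> parcs H `` {u}" for w
    using that arc_snd_in_verts by fastforce
  have finw: "finite (walks_from H l w)" if "w \<in> parcs H `` {u}" for w
    using Suc.IH[OF nbr[OF that]] by blast
  have "card (walks_from H (Suc l) u) = card (\<Union>w\<in>parcs H `` {u}. walks_from H l w)"
    unfolding walks_from_Suc[OF assms(1) Suc.prems] by (rule card_image) simp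
  also have "\<dots> = (\<Sum>w\<in>parcs H `` {u}. card (walks_from H l w))"
    using fin finw by (intro card_UN_disjoint) (auto simp: walks_from_def)
  also have "\<dots> = (\<Sum>w\<in>parcs H `` {u}. walk_count (parcs H) l w)"
    using Suc.IH nbr by (intro sum.cong) (auto simp: num_walks_from_def)
  finally show ?case
    using fin finw unfolding walks_from_Suc[OF assms(1) Suc.prems] num_walks_from_def by auto
qed

text \<open>
  In positive length the vertices of \<open>V\<close> outside \<open>H\<close> start no walk. The lengths have to be positive:
  for length 0 the left side is the number of vertices of \<open>H\<close> and the right side that of \<open>V\<close>.
\<close>

lemma num_walks_eq_sum_walk_count:
  assumes "pair_graph H" and "finite V" and "pverts H \<subseteq> V"
  shows "num_walks H (Suc l) = (\<Sum>u\<in>V. walk_count (parcs H) (Suc l) u)"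
proof -
  interpret pair_graph H by fact
  have "parcs H `` {u} = {}" if "u \<notin> pverts H" for u
    using that arc_fst_in_verts by fastforce
  then have "(\<Sum>u\<in>V. walk_count (parcs H) (Suc l) u) = (\<Sum>u\<in>pverts H. walk_count (parcs H) (Suc l) u)"
    using assms(2,3) by (intro sum.mono_neutral_right) auto
  also have "\<dots> = num_walks H (Suc l)"
    unfolding num_walks_def using num_walks_from_eq_walk_count[OF assms(1)] by (intro sum.cong) auto
  finally show ?thesis by simp
qed

text \<open>
  Substituting the equation into itself \<open>L\<close> times expresses \<open>x u\<close> as \<open>c\<close> times the \<open>L\<close>-th partial sum
  plus a remainder \<open>d L u\<close>. The remainder satisfies the homogeneous recursion, hence stays nonnegative,
  which bounds the partial sums and makes the series converge. The remainder is also at most a constant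
  times the \<open>L\<close>-th term of the series, so convergence in turn sends it to 0 and identifies the limit.
  In this way convergence follows from the existence of a nonnegative solution, without comparing
  \<open>\<rho>\<close> with the spectral radius of \<open>R\<close>.
\<close>

lemma walk_series_sums:
  fixes x :: "'a \<Rightarrow> real"
  assumes fin: "finite V" and R: "R \<subseteq> V \<times> V" and \<rho>: "0 < \<rho>" and c: "0 < c"
    and nonneg: "\<And>u. 0 \<le> x u"
    and eq: "\<And>u. u \<in> V \<Longrightarrow> \<rho> * x u = c + (\<Sum>w\<in>R `` {u}. x w)"
  shows "(\<lambda>l. real (\<Sum>u\<in>V. walk_count R l u) / \<rho> ^ (l + 1)) sums ((\<Sum>u\<in>V. x u) / c)"
proof -
  define M where "M = (\<Sum>u\<in>V. x u)"
  define d where "d L u = x u - c * (\<Sum>l<L. real (walk_count R l u) / \<rho> ^ (l + 1))" for L u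
  define w where "w l = real (\<Sum>u\<in>V. walk_count R l u) / \<rho> ^ (l + 1)" for l
  have d_Suc: "d (Suc L) u = (\<Sum>w\<in>R `` {u}. d L w) / \<rho>" if "u \<in> V" for L u
  proof -
    have "(\<Sum>l<Suc L. real (walk_count R l u) / \<rho> ^ (l + 1)) =
        1 / \<rho> + (\<Sum>l<L. (\<Sum>w\<in>R `` {u}. real (walk_count R l w) / \<rho> ^ (l + 1)) / \<rho>)"
      unfolding sum.lessThan_Suc_shift by (simp add: sum_divide_distrib mult.commute)
    also have "\<dots> = 1 / \<rho> + (\<Sum>w\<in>R `` {u}. \<Sum>l<L. real (walk_count R l w) / \<rho> ^ (l + 1)) / \<rho>"
      by (subst sum.swap) (simp add: sum_divide_distrib)
    finally have s: "(\<Sum>l<Suc L. real (walk_count R l u) / \<rho> ^ (l + 1)) =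
      1 / \<rho> + (\<Sum>w\<in>R `` {u}. \<Sum>l<L. real (walk_count R l w) / \<rho> ^ (l + 1)) / \<rho>" .
    have "x u = (c + (\<Sum>w\<in>R `` {u}. x w)) / \<rho>" using eq[OF that] \<rho> by (simp add: field_simps)
    then show ?thesis
      unfolding d_def s
      by (simp add: sum_subtractf sum_distrib_left add_divide_distrib diff_divide_distrib distrib_left)
  qed
  have d: "0 \<le> d L u \<and> d L u \<le> M * real (walk_count R L u) / \<rho> ^ L" if "u \<in> V" for L u
    using that
  proof (induction L arbitrary: u)
    case 0
    then show ?case using nonneg fin by (auto simp: d_def M_def intro: member_le_sum)
  next
    case (Suc L)
    have IH: "0 \<le> d L w" "d L w \<le> M * real (walk_count R L w) / \<rho> ^ L" if "w \<in> R `` {u}" for w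
      using Suc.IH[of w] that R by auto
    have "(\<Sum>w\<in>R `` {u}. d L w) \<le> (\<Sum>w\<in>R `` {u}. M * real (walk_count R L w) / \<rho> ^ L)"
      by (intro sum_mono IH)
    also have "\<dots> = M * real (walk_count R (Suc L) u) / \<rho> ^ L"
      by (simp add: sum_distrib_left sum_divide_distrib)
    finally have "d (Suc L) u \<le> M * real (walk_count R (Suc L) u) / \<rho> ^ L / \<rho>"
      unfolding d_Suc[OF Suc.prems] using \<rho> by (intro divide_right_mono) auto
    moreover have "0 \<le> d (Suc L) u"
      unfolding d_Suc[OF Suc.prems] using \<rho> IH(1) by (intro divide_nonneg_pos sum_nonneg) auto
    ultimately show ?case by (simp add: field_simps)
  qed
  have total: "(\<Sum>u\<in>V. d L u) = M - c * (\<Sum>l<L. w l)" for L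
  proof -
    have "(\<Sum>u\<in>V. d L u) = M - c * (\<Sum>u\<in>V. \<Sum>l<L. real (walk_count R l u) / \<rho> ^ (l + 1))"
      by (simp add: d_def M_def sum_subtractf sum_distrib_left)
    also have "(\<Sum>u\<in>V. \<Sum>l<L. real (walk_count R l u) / \<rho> ^ (l + 1)) = (\<Sum>l<L. w l)"
      by (subst sum.swap) (simp add: w_def sum_divide_distrib)
    finally show ?thesis .
  qed
  have low: "0 \<le> M - c * (\<Sum>l<L. w l)" for L
    unfolding total[symmetric] using d by (intro sum_nonneg) auto
  have high: "M - c * (\<Sum>l<L. w l) \<le> M * \<rho> * w L" for L
  proof -
    have "(\<Sum>u\<in>V. d L u) \<le> (\<Sum>u\<in>V. M * real (walk_count R L u) / \<rho> ^ L)"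
      using d by (intro sum_mono) auto
    also have "\<dots> = M * \<rho> * w L"
      using \<rho> by (simp add: w_def sum_distrib_left sum_divide_distrib)
    finally show ?thesis unfolding total .
  qed
  have "(\<Sum>l<L. w l) \<le> M / c" for L
    using low[of L] c by (simp add: field_simps)
  then have "summable w"
    using \<rho> by (intro summableI_nonneg_bounded[of w "M / c"]) (auto simp: w_def sum_nonneg)
  then have upper: "(\<lambda>L. M * \<rho> * w L) \<longlonglongrightarrow> 0"
    using tendsto_mult_right_zero[OF summable_LIMSEQ_zero] by blast
  have "(\<lambda>L. M - c * (\<Sum>l<L. w l)) \<longlonglongrightarrow> 0"
  proof (rule tendsto_sandwich[OF _ _ tendsto_const upper])
    show "\<forall>\<^sub>F L in sequentially. 0 \<le> M - c * (\<Sum>l<L. w l)"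
      by (rule always_eventually) (rule allI[OF low])
    show "\<forall>\<^sub>F L in sequentially. M - c * (\<Sum>l<L. w l) \<le> M * \<rho> * w L"
      by (rule always_eventually) (rule allI[OF high])
  qed
  then have "(\<lambda>L. (M - (M - c * (\<Sum>l<L. w l))) / c) \<longlonglongrightarrow> (M - 0) / c"
    using c by (intro tendsto_divide tendsto_diff tendsto_const) simp_all
  then have "w sums (M / c)" using c by (simp add: sums_def)
  then show ?thesis by (simp add: w_def[abs_def] M_def)
qed

section \<open>Complete multipartite graphs with embedded edges\<close>

lemma pverts_multipartite_embed:
  "pverts (embed_edges (complete_multipartite I V) I H) = (\<Union>i\<in>I. V i)"
  by (simp add: embed_edges_def complete_multipartite_def)

lemma multipartite_embed_nbrs:
  assumes dj: "disjoint_family_on V I"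
    and H: "\<And>i. i \<in> I \<Longrightarrow> pair_graph (H i)" and HV: "\<And>i. i \<in> I \<Longrightarrow> pverts (H i) \<subseteq> V i"
    and s: "s \<in> I" "u \<in> V s"
  shows "parcs (embed_edges (complete_multipartite I V) I H) `` {u} =
    ((\<Union>i\<in>I. V i) - V s) \<union> parcs (H s) `` {u}"
proof -
  have sub: "parcs (H i) \<subseteq> V i \<times> V i" if "i \<in> I" for i
  proof -
    interpret pair_graph "H i" by (rule H[OF that])
    show ?thesis using HV[OF that] arc_fst_in_verts arc_snd_in_verts by fastforce
  qed
  have part: "i = s" if "i \<in> I" "u \<in> V i" for i
    using that s dj by (auto simp: disjoint_family_on_def)
  have other: "w \<notin> V s" if "j \<in> I" "j \<noteq> s" "w \<in> V j" for j w
    using that s dj by (auto simp: disjoint_family_on_def)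
  have "(u, w) \<in> parcs (embed_edges (complete_multipartite I V) I H) \<longleftrightarrow>
      w \<in> (\<Union>i\<in>I. V i) - V s \<or> (u, w) \<in> parcs (H s)" for w
  proof -
    have "(u, w) \<in> parcs (embed_edges (complete_multipartite I V) I H) \<longleftrightarrow>
        (\<exists>i\<in>I. u \<in> V i \<and> (\<exists>j\<in>I - {i}. w \<in> V j)) \<or> (\<exists>i\<in>I. (u, w) \<in> parcs (H i))"
      unfolding embed_edges_def complete_multipartite_def by simp
    moreover have "(\<exists>i\<in>I. u \<in> V i \<and> (\<exists>j\<in>I - {i}. w \<in> V j)) \<longleftrightarrow> (\<exists>j\<in>I - {s}. w \<in> V j)"
      using s part by blast
    moreover have "(\<exists>j\<in>I - {s}. w \<in> V j) \<longleftrightarrow> w \<in> (\<Union>i\<in>I. V i) - V s"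
      using other by blast
    moreover have "u \<in> V i" if "i \<in> I" "(u, w) \<in> parcs (H i)" for i
      using sub[OF that(1)] that(2) by blast
    then have "(\<exists>i\<in>I. (u, w) \<in> parcs (H i)) \<longleftrightarrow> (u, w) \<in> parcs (H s)"
      using s(1) part by blast
    ultimately show ?thesis by simp
  qed
  then show ?thesis by blast
qed

theorem theorem1p2:
  fixes r :: nat
    and V :: "nat \<Rightarrow> 'a set"
    and n :: "nat \<Rightarrow> nat"
    and H :: "nat \<Rightarrow> 'a pair_pre_digraph"
    and G :: "'a pair_pre_digraph"
    and \<rho> :: real
  assumes "r \<ge> 2"
    and "\<And>i. i \<in> {1..r} \<Longrightarrow> finite (V i)"
    and "disjoint_family_on V {1..r}"
    and "\<And>i. i \<in> {1..r} \<Longrightarrow> n i = card (V i)"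
    and "\<And>i. i \<in> {1..r} \<Longrightarrow> n i \<ge> 1"
    and "\<And>i. i \<in> {1..r} \<Longrightarrow> pair_graph (H i)"
    and "\<And>i. i \<in> {1..r} \<Longrightarrow> pverts (H i) \<subseteq> V i"
    and "G = embed_edges (complete_multipartite {1..r} V) {1..r} H"
    and "\<rho> = graph_spectral_radius G"
  shows "(\<forall>s\<in>{1..r}. summable (\<lambda>i. real (num_walks (H s) (Suc i)) / \<rho> ^ (Suc i + 1))) \<and>
    (\<Sum>s = 1..r. 1 / (1 + real (n s) / \<rho> +
        (\<Sum>i. real (num_walks (H s) (Suc i)) / \<rho> ^ (Suc i + 1)))) = real r - 1"
proof -
  let ?U = "\<Union>i\<in>{1..r}. V i"
  have V_ne: "V i \<noteq> {}" if "i \<in> {1..r}" for i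
    using assms(4,5)[OF that] by (intro notI) simp
  have G: "pair_graph G"
    unfolding assms(8) using assms(2,3,6,7) by (intro pair_graph_multipartite_embed) auto
  have GU: "pverts G = ?U" unfolding assms(8) by (rule pverts_multipartite_embed)
  have nbrs: "parcs G `` {u} = (?U - V s) \<union> parcs (H s) `` {u}" if "s \<in> {1..r}" "u \<in> V s" for s u
    unfolding assms(8) using assms(3,6,7) that by (intro multipartite_embed_nbrs)
  have finU: "finite ?U" using assms(2) by auto
  have "1 \<in> {1..r}" using assms(1) by simp
  then have "pverts G \<noteq> {}" using V_ne unfolding GU by blast
  from graph_spectral_radius_eigenvector[OF G this]
  obtain x where x: "\<And>u. 0 \<le> x u" "\<exists>u\<in>?U. 0 < x u"
    and eig: "\<And>u. u \<in> ?U \<Longrightarrow> (\<Sum>w\<in>parcs G `` {u}. x w) = \<rho> * x u"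
    unfolding GU assms(9) by blast
  have sub: "parcs (H s) \<subseteq> V s \<times> V s" if "s \<in> {1..r}" for s
  proof -
    interpret pair_graph "H s" by (rule assms(6)[OF that])
    show ?thesis using assms(7)[OF that] arc_fst_in_verts arc_snd_in_verts by fastforce
  qed
  have disjoint: "v \<notin> V j" if "i \<in> {1..r}" "j \<in> {1..r}" "i \<noteq> j" "v \<in> V i" for i j v
    using disjoint_family_onD[OF assms(3) that(1,2,3)] that(4) by blast
  define c where "c s = (\<Sum>w\<in>?U - V s. x w)" for s
  have split: "\<rho> * x u = c s + (\<Sum>w\<in>parcs (H s) `` {u}. x w)" if "s \<in> {1..r}" "u \<in> V s" for s u
  proof -
    have "finite (parcs (H s) `` {u})" "(?U - V s) \<inter> parcs (H s) `` {u} = {}"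
      using sub[OF that(1)] assms(2)[OF that(1)] by (auto intro: finite_subset)
    then have "(\<Sum>w\<in>parcs G `` {u}. x w) = c s + (\<Sum>w\<in>parcs (H s) `` {u}. x w)"
      unfolding nbrs[OF that] c_def using finU by (intro sum.union_disjoint) auto
    moreover have "u \<in> ?U" using that by blast
    ultimately show ?thesis using eig[of u] by linarith
  qed
  \<comment> \<open>A positive entry at \<open>u\<close> in part \<open>s\<close> makes \<open>c t\<close>, hence \<open>\<rho> * x w\<close>, positive for every vertex \<open>w\<close>
    of any other part \<open>t\<close>. As \<open>r\<close> is at least 2, such a \<open>w\<close> exists, and its entry makes \<open>c s\<close> positive.\<close>
  obtain u s where u: "0 < x u" "u \<in> V s" and s: "s \<in> {1..r}" using x(2) by blast
  have other_part: "0 < c t" "0 < \<rho> * x w" if t: "t \<in> {1..r}" "t \<noteq> s" and w: "w \<in> V t" for t w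
  proof -
    have "u \<notin> V t" using disjoint[OF s t(1) _ u(2)] t(2) by simp
    then have "u \<in> ?U - V t" using u(2) s by blast
    then have "x u \<le> c t"
      unfolding c_def using finU x(1) by (intro member_le_sum) auto
    then show "0 < c t" using u(1) by simp
    then show "0 < \<rho> * x w"
      using split[OF t(1) w] x(1) sum_nonneg[of "parcs (H t) `` {w}" x] by auto
  qed
  obtain t where t: "t \<in> {1..r}" "t \<noteq> s"
  proof -
    have "(if s = 1 then 2 else 1) \<in> {1..r}" using assms(1) by auto
    then show thesis using that by (metis one_eq_numeral_iff semiring_norm(85))
  qed
  obtain w where w: "w \<in> V t" using V_ne[OF t(1)] by blast
  have \<rho>: "0 < \<rho>" and xw: "0 < x w"
    using other_part(2)[OF t w] x(1)[of w] by (auto simp: zero_less_mult_iff)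
  have c: "0 < c i" if "i \<in> {1..r}" for i
  proof (cases "i = s")
    case True
    have "w \<notin> V s" using disjoint[OF t(1) s t(2) w] .
    then have "w \<in> ?U - V s" using w t(1) by blast
    then have "x w \<le> c s"
      unfolding c_def using finU x(1) by (intro member_le_sum) auto
    then show ?thesis using xw True by simp
  next
    case False
    then show ?thesis using other_part(1) that V_ne[OF that] by blast
  qed
  define T where "T = (\<Sum>w\<in>?U. x w)"
  have T: "T = c i + (\<Sum>w\<in>V i. x w)" if "i \<in> {1..r}" for i
    unfolding T_def c_def using that finU by (intro sum.subset_diff UN_upper)
  have "0 \<le> (\<Sum>w\<in>V s. x w)" using x(1) by (rule sum_nonneg)
  then have T_pos: "0 < T" using T[OF s] c[OF s] by linarith
  have series: "(\<lambda>l. real (num_walks (H i) (Suc l)) / \<rho> ^ (Suc l + 1)) sums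
      (T / c i - 1 - real (n i) / \<rho>)" if i: "i \<in> {1..r}" for i
  proof -
    let ?w = "\<lambda>l. real (\<Sum>u\<in>V i. walk_count (parcs (H i)) l u) / \<rho> ^ (l + 1)"
    have "?w sums ((\<Sum>u\<in>V i. x u) / c i)"
      using walk_series_sums[OF assms(2)[OF i] sub[OF i] \<rho> c[OF i] x(1) split[OF i]] by blast
    \<comment> \<open>The term for length 0 is \<open>n i / \<rho>\<close>; it is split off because \<open>H i\<close> may miss vertices of \<open>V i\<close>.\<close>
    then have "(\<lambda>l. ?w (Suc l)) sums ((\<Sum>u\<in>V i. x u) / c i - ?w 0)"
      by (subst sums_Suc_iff) simp
    moreover have "?w (Suc l) = real (num_walks (H i) (Suc l)) / \<rho> ^ (Suc l + 1)" for l
      using num_walks_eq_sum_walk_count[OF assms(6)[OF i] assms(2)[OF i] assms(7)[OF i]] by simp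
    moreover have "(\<Sum>u\<in>V i. x u) / c i - ?w 0 = T / c i - 1 - real (n i) / \<rho>"
      using T[OF i] c[OF i] assms(4)[OF i] by (simp add: add_divide_distrib)
    ultimately show ?thesis by (simp only:)
  qed
  have summand: "1 / (1 + real (n i) / \<rho> + (\<Sum>l. real (num_walks (H i) (Suc l)) / \<rho> ^ (Suc l + 1))) =
      c i / T" if "i \<in> {1..r}" for i
    unfolding sums_unique[OF series[OF that], symmetric] by simp
  \<comment> \<open>Summing \<open>T = c i + (T - c i)\<close> over the parts, the entries inside the parts add up to \<open>T\<close>.\<close>
  have "(\<Sum>i = 1..r. c i) + (\<Sum>i = 1..r. \<Sum>w\<in>V i. x w) = (\<Sum>i = 1..r. T)"
    unfolding sum.distrib[symmetric] by (intro sum.cong refl T[symmetric])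
  moreover have "(\<Sum>i = 1..r. \<Sum>w\<in>V i. x w) = T"
    unfolding T_def using assms(2,3)
    by (subst sum.UNION_disjoint) (auto simp: disjoint_family_on_def)
  ultimately have "(\<Sum>i = 1..r. c i) = (real r - 1) * T"
    by (simp add: algebra_simps)
  then have sum_c: "(\<Sum>i = 1..r. c i / T) = real r - 1"
    using T_pos by (simp add: sum_divide_distrib[symmetric])
  have sum_eq: "(\<Sum>i = 1..r. 1 / (1 + real (n i) / \<rho> +
      (\<Sum>l. real (num_walks (H i) (Suc l)) / \<rho> ^ (Suc l + 1)))) = (\<Sum>i = 1..r. c i / T)"
    by (intro sum.cong refl summand)
  show ?thesis
    by (intro conjI ballI) (erule sums_summable[OF series], rule trans[OF sum_eq sum_c])
qed

end
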